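(* Let $\psi:[0,1]\to\mathbb{C}$ be a continuous function of bounded variation on $[0,1]$ with $\psi(0)=\psi(1)=0$ and $\psi(x)/x\in L_2(0,1)$. Let $$\hat\psi(t)=\int_0^1 e^{itx}\psi(x)\,dx,\qquad \Psi(t)=\int_0^1 e^{itx}\,d\psi(x).$$ Suppose that (i) $t^m\hat\psi^{(m)}(t)\in L_1(1,\infty)$ for $m=0,1,2$, and (ii) $t^m\hat\psi^{(m-1)}(t)=o(1)$ as $t\to\infty$ for $m=1,2$. Then $\Psi(t)=o(1)$ as $|t|\to\infty$, i.e. $\psi$ supports a Rajchman measure.
   Context: A function of bounded variation supports a Rajchman measure if the Fourier–Stieltjes transform of the associated measure tends to zero at infinity. *)

theory Defs
  imports "HOL-Analysis.Analysis"
begin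

definition bounded_variation_on :: "(real \<Rightarrow> 'a::real_normed_vector) \<Rightarrow> real \<Rightarrow> real \<Rightarrow> bool" where
  "bounded_variation_on f a b \<longleftrightarrow>
     (\<exists>B. \<forall>d. d division_of {a..b} \<longrightarrow> (\<Sum>K\<in>d. norm (f (Sup K) - f (Inf K))) \<le> B)"

definition has_RS_integral :: "(real \<Rightarrow> complex) \<Rightarrow> (real \<Rightarrow> complex) \<Rightarrow> real \<Rightarrow> real \<Rightarrow> complex \<Rightarrow> bool" where
  "has_RS_integral f g a b I \<longleftrightarrow>
     (\<forall>e>0. \<exists>\<delta>>0. \<forall>p. p tagged_division_of {a..b} \<and> (\<lambda>x. ball x \<delta>) fine p \<longrightarrow>
        norm ((\<Sum>(x,K)\<in>p. f x * (g (Sup K) - g (Inf K))) - I) < e)"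

definition RS_integral :: "(real \<Rightarrow> complex) \<Rightarrow> (real \<Rightarrow> complex) \<Rightarrow> real \<Rightarrow> real \<Rightarrow> complex" where
  "RS_integral f g a b = (THE I. has_RS_integral f g a b I)"

definition fourier01 :: "(real \<Rightarrow> complex) \<Rightarrow> real \<Rightarrow> complex" where
  "fourier01 \<psi> t = integral {0..1} (\<lambda>x. exp (\<i> * complex_of_real (t * x)) * \<psi> x)"

definition fourier_stieltjes01 :: "(real \<Rightarrow> complex) \<Rightarrow> real \<Rightarrow> complex" where
  "fourier_stieltjes01 \<psi> t = RS_integral (\<lambda>x. exp (\<i> * complex_of_real (t * x))) \<psi> 0 1"

definition nth_deriv :: "nat \<Rightarrow> (real \<Rightarrow> complex) \<Rightarrow> real \<Rightarrow> complex" where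
  "nth_deriv m f = ((\<lambda>g t. vector_derivative g (at t)) ^^ m) f"

end

theory Submission
  imports Defs
begin

text \<open>
  Integration by parts gives \<open>\<Psi> t = - \<i> t \<psi>^(t)\<close>, so the hypothesis on \<open>t \<psi>^(t)\<close> is exactly decay
  at \<open>+\<infinity>\<close>. Decay at \<open>-\<infinity>\<close> is Rajchman's theorem for the complex measure \<open>d\<psi>\<close>: the measures \<open>\<nu>\<close>
  whose transform vanishes at \<open>+\<infinity>\<close> are stable under multiplication by trigonometric sums and
  under limits in total variation, and the conjugate of \<open>d\<psi>\<close> is such a limit. Indeed, choose
  continuous \<open>f\<close> with \<open>\<bar>f\<bar> \<le> 1\<close> for which \<open>Re (\<integral> f d\<psi>)\<close> is close to the total variation; then
  \<open>f d\<psi>\<close> is nearly a positive measure, whence \<open>f\<^sup>2 d\<psi>\<close> is close to the conjugate of \<open>d\<psi>\<close>, and \<open>f\<^sup>2\<close> is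
  a uniform limit of trigonometric sums on \<open>[0,1]\<close>. All measures are handled through
  Riemann--Stieltjes sums over fine tagged divisions.
\<close>

section \<open>Riemann--Stieltjes sums\<close>

definition RS_sum :: "(real \<Rightarrow> complex) \<Rightarrow> (real \<Rightarrow> complex) \<Rightarrow> (real \<times> real set) set \<Rightarrow> complex" where
  "RS_sum f g p = (\<Sum>z\<in>p. f (fst z) * (g (Sup (snd z)) - g (Inf (snd z))))"

text \<open>Convergence along this filter is the limit as the mesh tends to zero, so that Riemann--Stieltjes
  integrals inherit the algebra of limits.\<close>
definition mesh_filter :: "real \<Rightarrow> real \<Rightarrow> (real \<times> real set) set filter" where
  "mesh_filter a b = (INF \<delta>\<in>{0<..}. principal {p. p tagged_division_of {a..b} \<and> (\<lambda>x. ball x \<delta>) fine p})"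

lemma fine_ball_mono: "(\<lambda>x. ball x \<delta>) fine p \<Longrightarrow> \<delta> \<le> \<delta>' \<Longrightarrow> (\<lambda>x. ball x \<delta>') fine p"
  unfolding fine_def by fastforce

text \<open>The smaller of two meshes refines both conditions, so the generating sets form a filter
  base. A single \<open>\<delta>\<close> then decides eventual truth, which is the quantifier
  pattern of \<open>has_RS_integral\<close>.\<close>

lemma eventually_mesh_filter:
  "eventually P (mesh_filter a b) \<longleftrightarrow>
     (\<exists>\<delta>>0. \<forall>p. p tagged_division_of {a..b} \<and> (\<lambda>x. ball x \<delta>) fine p \<longrightarrow> P p)"
proof -
  have "eventually P (mesh_filter a b) \<longleftrightarrow>
    (\<exists>\<delta>\<in>{0<..}. eventually P (principal {p. p tagged_division_of {a..b} \<and> (\<lambda>x. ball x \<delta>) fine p}))"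
    unfolding mesh_filter_def
  proof (rule eventually_INF_base)
    fix \<delta> \<delta>' :: real
    assume "\<delta> \<in> {0<..}" "\<delta>' \<in> {0<..}"
    then show "\<exists>x\<in>{0<..}. principal {p. p tagged_division_of {a..b} \<and> (\<lambda>y. ball y x) fine p}
       \<le> inf (principal {p. p tagged_division_of {a..b} \<and> (\<lambda>x. ball x \<delta>) fine p})
             (principal {p. p tagged_division_of {a..b} \<and> (\<lambda>x. ball x \<delta>') fine p})"
      by (intro bexI[of _ "min \<delta> \<delta>'"]) (auto intro: fine_ball_mono)
  qed auto
  then show ?thesis
    by (auto simp: eventually_principal)
qed

text \<open>By Cousin's lemma every gauge admits a fine tagged division. Hence limits along the
  filter are unique, and bounds on sums pass to integrals.\<close>

lemma mesh_filter_neq_bot: "mesh_filter a b \<noteq> bot"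
proof
  assume "mesh_filter a b = bot"
  then have "eventually (\<lambda>_. False) (mesh_filter a b)"
    by simp
  then obtain \<delta> where "\<delta> > 0"
    and none: "\<And>p. \<not> (p tagged_division_of {a..b} \<and> (\<lambda>x. ball x \<delta>) fine p)"
    unfolding eventually_mesh_filter by blast
  have "gauge (\<lambda>x::real. ball x \<delta>)"
    using \<open>\<delta> > 0\<close> by (auto simp: gauge_def)
  then show False
    by (metis fine_division_exists_real none)
qed

lemma eventually_mesh_tagged_division:
  "eventually (\<lambda>p. p tagged_division_of {a..b}) (mesh_filter a b)"
  unfolding eventually_mesh_filter using zero_less_one by blast

lemma has_RS_integral_iff_tendsto:
  "has_RS_integral f g a b I \<longleftrightarrow> (RS_sum f g \<longlongrightarrow> I) (mesh_filter a b)"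
  unfolding has_RS_integral_def tendsto_iff eventually_mesh_filter dist_norm RS_sum_def case_prod_unfold
  by simp

lemma RS_integral_eqI:
  assumes "has_RS_integral f g a b I"
  shows "RS_integral f g a b = I"
  unfolding RS_integral_def
proof (rule the_equality)
  show "has_RS_integral f g a b I" by fact
  fix J assume "has_RS_integral f g a b J"
  then show "J = I"
    using assms mesh_filter_neq_bot tendsto_unique
    unfolding has_RS_integral_iff_tendsto by blast
qed

lemma has_RS_integral_add:
  assumes "has_RS_integral f g a b I" "has_RS_integral h g a b J"
  shows "has_RS_integral (\<lambda>x. f x + h x) g a b (I + J)"
proof -
  have "RS_sum (\<lambda>x. f x + h x) g = (\<lambda>p. RS_sum f g p + RS_sum h g p)"
    by (simp add: RS_sum_def sum.distrib distrib_right fun_eq_iff)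
  then show ?thesis
    using assms by (auto simp: has_RS_integral_iff_tendsto intro: tendsto_add)
qed

lemma has_RS_integral_mult_left:
  assumes "has_RS_integral f g a b I"
  shows "has_RS_integral (\<lambda>x. c * f x) g a b (c * I)"
proof -
  have "RS_sum (\<lambda>x. c * f x) g = (\<lambda>p. c * RS_sum f g p)"
    by (auto simp: RS_sum_def sum_distrib_left mult.assoc)
  then show ?thesis
    using assms by (auto simp: has_RS_integral_iff_tendsto intro: tendsto_mult_left)
qed

lemma has_RS_integral_sum:
  assumes "finite S" "\<And>i. i \<in> S \<Longrightarrow> has_RS_integral (f i) g a b (I i)"
  shows "has_RS_integral (\<lambda>x. \<Sum>i\<in>S. f i x) g a b (\<Sum>i\<in>S. I i)"
  using assms
proof (induction S)
  case empty
  have "RS_sum (\<lambda>x. 0) g = (\<lambda>_. 0)"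
    by (auto simp: RS_sum_def)
  then show ?case
    by (simp add: has_RS_integral_iff_tendsto)
next
  case (insert i S)
  then show ?case
    using has_RS_integral_add[of "f i" g a b "I i" "\<lambda>x. \<Sum>i\<in>S. f i x" "\<Sum>i\<in>S. I i"] by auto
qed

lemma has_RS_integral_cnj:
  assumes "has_RS_integral f g a b I"
  shows "has_RS_integral (\<lambda>x. cnj (f x)) (\<lambda>x. cnj (g x)) a b (cnj I)"
proof -
  have "RS_sum (\<lambda>x. cnj (f x)) (\<lambda>x. cnj (g x)) = (\<lambda>p. cnj (RS_sum f g p))"
    by (auto simp: RS_sum_def)
  then show ?thesis
    using assms by (auto simp: has_RS_integral_iff_tendsto intro: tendsto_cnj)
qed

lemma tagged_division_of_realE:
  fixes a b :: real
  assumes "p tagged_division_of {a..b}" "z \<in> p"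
  obtains u v where "snd z = {u..v}" "a \<le> u" "u \<le> fst z" "fst z \<le> v" "v \<le> b"
proof -
  obtain x K where z: "z = (x, K)"
    by (cases z)
  obtain u v where "K = cbox u v"
    using tagged_division_ofD(4)[OF assms(1)] assms(2) z by blast
  moreover have "x \<in> K" "K \<subseteq> {a..b}"
    using tagged_division_ofD(2,3)[OF assms(1)] assms(2) z by blast+
  ultimately show ?thesis
    using that[of u v] z by auto
qed

text \<open>On each tagged interval the error is controlled by a change of \<open>f\<close>, at most
  a constant times the length, multiplied by an oscillation of \<open>\<psi>\<close>, small by
  uniform continuity. The lengths sum to \<open>b - a\<close>.\<close>

lemma has_RS_integral_by_parts:
  fixes f \<psi> :: "real \<Rightarrow> complex"
  assumes "a \<le> b" and cont: "continuous_on {a..b} \<psi>" and cont': "continuous_on {a..b} f'"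
    and deriv: "\<And>x. x \<in> {a..b} \<Longrightarrow> (f has_vector_derivative f' x) (at x within {a..b})"
  shows "has_RS_integral f \<psi> a b (f b * \<psi> b - f a * \<psi> a - integral {a..b} (\<lambda>x. f' x * \<psi> x))"
    (is "has_RS_integral _ _ _ _ ?I")
  unfolding has_RS_integral_iff_tendsto tendsto_iff eventually_mesh_filter
proof (intro allI impI)
  fix e :: real assume "e > 0"
  obtain M where M: "M > 0" "\<And>x. x \<in> {a..b} \<Longrightarrow> norm (f' x) \<le> M"
    using compact_imp_bounded[OF compact_continuous_image[OF cont' compact_Icc]]
    unfolding bounded_pos by blast
  \<comment> \<open>Each interval contributes three terms of size \<open>M * \<omega>\<close> times
    its length, so the total stays below \<open>e / 2\<close>. The \<open>+ 1\<close> keeps the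
    denominator positive when \<open>a = b\<close>.\<close>
  define \<omega> where "\<omega> = e / (6 * M * (b - a + 1))"
  have "\<omega> > 0"
    using \<open>e > 0\<close> \<open>M > 0\<close> \<open>a \<le> b\<close> by (simp add: \<omega>_def)
  then obtain \<delta> where "\<delta> > 0" and
    \<delta>: "\<And>x y. x \<in> {a..b} \<Longrightarrow> y \<in> {a..b} \<Longrightarrow> dist y x < \<delta> \<Longrightarrow> dist (\<psi> y) (\<psi> x) < \<omega>"
    using compact_uniformly_continuous[OF cont compact_Icc] by (metis uniformly_continuous_onE)
  show "\<exists>\<delta>>0. \<forall>p. p tagged_division_of {a..b} \<and> (\<lambda>x. ball x \<delta>) fine p \<longrightarrow> dist (RS_sum f \<psi> p) ?I < e"
  proof (intro exI[of _ \<delta>] conjI allI impI \<open>\<delta> > 0\<close>)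
    fix p :: "(real \<times> real set) set"
    assume p: "p tagged_division_of {a..b} \<and> (\<lambda>x. ball x \<delta>) fine p"
    have int: "(\<lambda>x. f' x * \<psi> x) integrable_on {a..b}"
      by (intro integrable_continuous_real continuous_intros cont cont')
    \<comment> \<open>The defect of integration by parts on one interval. Boundary terms telescope
      and integrals add up, so these defects sum to the whole error.\<close>
    define E where "E z = f (fst z) * (\<psi> (Sup (snd z)) - \<psi> (Inf (snd z)))
      - (f (Sup (snd z)) * \<psi> (Sup (snd z)) - f (Inf (snd z)) * \<psi> (Inf (snd z))
         - integral (snd z) (\<lambda>x. f' x * \<psi> x))" for z
    have "?I = (\<Sum>z\<in>p. f (Sup (snd z)) * \<psi> (Sup (snd z)) - f (Inf (snd z)) * \<psi> (Inf (snd z))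
         - integral (snd z) (\<lambda>x. f' x * \<psi> x))"
      using additive_tagged_division_1[OF \<open>a \<le> b\<close>, of p "\<lambda>x. f x * \<psi> x"] p
        integral_combine_tagged_division_topdown[of "\<lambda>x. f' x * \<psi> x" a b p] int
      by (simp add: sum_subtractf case_prod_unfold)
    then have "RS_sum f \<psi> p - ?I = (\<Sum>z\<in>p. E z)"
      by (simp add: RS_sum_def E_def sum_subtractf)
    moreover have "norm (E z) \<le> 3 * M * \<omega> * (Sup (snd z) - Inf (snd z))" if "z \<in> p" for z
    proof -
      obtain x where x: "x = fst z" by blast
      obtain u v where uv: "snd z = {u..v}" "a \<le> u" "u \<le> x" "x \<le> v" "v \<le> b"
        by (rule tagged_division_of_realE[OF conjunct1[OF p] \<open>z \<in> p\<close>]) (simp add: x)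
      have "snd z \<subseteq> ball x \<delta>"
        using p \<open>z \<in> p\<close> x by (auto simp: fine_def case_prod_unfold)
      then have close: "norm (\<psi> s - \<psi> x) \<le> \<omega>" if "s \<in> {u..v}" for s
        using \<delta>[of x s] that uv by (auto simp: dist_norm dist_commute subset_iff norm_minus_commute less_imp_le)
      have lip: "norm (f s - f r) \<le> M * (v - u)" if "s \<in> {u..v}" "r \<in> {u..v}" for s r
      proof -
        have "norm (f s - f r) \<le> M * norm (s - r)"
        proof (rule differentiable_bound[of "{a..b}" f "\<lambda>x h. h *\<^sub>R f' x"])
          show "onorm (\<lambda>h. h *\<^sub>R f' x) \<le> M" if "x \<in> {a..b}" for x
            using M(2)[OF that] by (intro onorm_le) (simp add: mult.commute[of M] mult_left_mono)
        qed (use deriv that uv in \<open>auto simp: has_vector_derivative_def\<close>)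
        also have "\<dots> \<le> M * (v - u)"
          using that \<open>M > 0\<close> by (intro mult_left_mono) auto
        finally show ?thesis .
      qed
      have sub: "{u..v} \<subseteq> {a..b}"
        using uv by auto
      have "(f' has_integral (f v - f u)) {u..v}"
        using uv sub by (intro fundamental_theorem_of_calculus)
          (auto intro!: has_vector_derivative_within_subset[OF deriv])
      then have "((\<lambda>s. f' s * \<psi> x) has_integral ((f v - f u) * \<psi> x)) {u..v}"
        by (rule has_integral_mult_left)
      moreover have "((\<lambda>s. f' s * \<psi> s) has_integral (integral {u..v} (\<lambda>s. f' s * \<psi> s))) {u..v}"
        using integrable_on_subinterval[OF int sub] by (rule integrable_integral)
      ultimately have "((\<lambda>s. f' s * \<psi> s - f' s * \<psi> x) has_integral
          (integral {u..v} (\<lambda>s. f' s * \<psi> s) - (f v - f u) * \<psi> x)) (cbox u v)"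
        by (auto intro: has_integral_diff)
      then have 1: "norm (integral {u..v} (\<lambda>s. f' s * \<psi> s) - (f v - f u) * \<psi> x) \<le> M * \<omega> * (v - u)"
      proof (rule has_integral_bound[where B = "M * \<omega>", THEN order_trans, rotated])
        show "norm (f' s * \<psi> s - f' s * \<psi> x) \<le> M * \<omega>" if "s \<in> cbox u v" for s
        proof -
          have "norm (f' s * \<psi> s - f' s * \<psi> x) = norm (f' s) * norm (\<psi> s - \<psi> x)"
            by (metis norm_mult right_diff_distrib)
          also have "\<dots> \<le> M * \<omega>"
            using M that close sub \<open>\<omega> > 0\<close> by (intro mult_mono) auto
          finally show ?thesis .
        qed
      qed (use M \<open>\<omega> > 0\<close> uv in auto)
      have 2: "norm ((f v - f x) * (\<psi> v - \<psi> x)) \<le> M * (v - u) * \<omega>"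
        unfolding norm_mult using uv M(1) by (intro mult_mono lip close) auto
      have 3: "norm ((f u - f x) * (\<psi> u - \<psi> x)) \<le> M * (v - u) * \<omega>"
        unfolding norm_mult using uv M(1) by (intro mult_mono lip close) auto
      \<comment> \<open>Centred at the tag \<open>x\<close>, each of the three terms contains a
        difference \<open>\<psi> s - \<psi> x\<close>; the first is the integral of
        \<open>f' s * (\<psi> s - \<psi> x)\<close>.\<close>
      have "E z = (integral {u..v} (\<lambda>s. f' s * \<psi> s) - (f v - f u) * \<psi> x)
          - (f v - f x) * (\<psi> v - \<psi> x) + (f u - f x) * (\<psi> u - \<psi> x)"
        using uv by (simp add: E_def x algebra_simps)
      also have "norm \<dots> \<le> M * \<omega> * (v - u) + M * (v - u) * \<omega> + M * (v - u) * \<omega>"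
        by (intro norm_triangle_mono norm_triangle_le_diff add_mono 1 2 3 order_trans[OF norm_triangle_ineq4])
      finally show ?thesis
        using uv by (simp add: algebra_simps)
    qed
    ultimately have "norm (RS_sum f \<psi> p - ?I) \<le> (\<Sum>z\<in>p. 3 * M * \<omega> * (Sup (snd z) - Inf (snd z)))"
      by (simp add: sum_norm_le)
    also have "\<dots> = 3 * M * \<omega> * (b - a)"
      using additive_tagged_division_1[OF \<open>a \<le> b\<close>, of p "\<lambda>x. x"] p
      by (simp add: sum_distrib_left[symmetric] case_prod_unfold)
    also have "\<dots> < e"
    proof -
      have "3 * M * \<omega> * (b - a) = e * ((b - a) / (2 * (b - a + 1)))"
      proof -
        have "3 * M * (e / (6 * M * L)) * c = e * (c / (2 * L))" if "L > 0" for L c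
          using \<open>M > 0\<close> that by (simp add: field_simps)
        then show ?thesis
          using \<open>a \<le> b\<close> by (simp add: \<omega>_def)
      qed
      also have "\<dots> < e * 1"
        using \<open>a \<le> b\<close> \<open>e > 0\<close> by (intro mult_strict_left_mono) (auto simp: field_simps)
      finally show ?thesis by simp
    qed
    finally show "dist (RS_sum f \<psi> p) ?I < e"
      by (simp add: dist_norm)
  qed
qed

section \<open>Trigonometric sums and the arctan kernel\<close>

text \<open>Arbitrary real frequencies are allowed, so these functions need not have period 1 and
  can separate the endpoints of \<open>{0..1}\<close>. Multiplying characters adds frequencies,
  which makes the class an algebra.\<close>

inductive trig_sum :: "(real \<Rightarrow> complex) \<Rightarrow> bool" where
  character: "trig_sum (\<lambda>x. c * exp (\<i> * complex_of_real (\<theta> * x)))"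
| add: "trig_sum f \<Longrightarrow> trig_sum g \<Longrightarrow> trig_sum (\<lambda>x. f x + g x)"

lemma trig_sum_mult_character:
  "trig_sum f \<Longrightarrow> trig_sum (\<lambda>x. c * exp (\<i> * complex_of_real (\<theta> * x)) * f x)"
proof (induction rule: trig_sum.induct)
  case (character c' \<theta>')
  have "(\<lambda>x. c * exp (\<i> * complex_of_real (\<theta> * x)) * (c' * exp (\<i> * complex_of_real (\<theta>' * x))))
      = (\<lambda>x. (c * c') * exp (\<i> * complex_of_real ((\<theta> + \<theta>') * x)))"
    by (simp add: fun_eq_iff distrib_left distrib_right exp_add)
  then show ?case
    using trig_sum.character by metis
next
  case (add f g)
  then show ?case
    using trig_sum.add[OF add.IH] by (simp add: distrib_left)
qed

lemma trig_sum_mult: "trig_sum f \<Longrightarrow> trig_sum g \<Longrightarrow> trig_sum (\<lambda>x. f x * g x)"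
proof (induction rule: trig_sum.induct)
  case (character c \<theta>)
  then show ?case by (rule trig_sum_mult_character)
next
  case (add f h)
  then show ?case
    using trig_sum.add[of "\<lambda>x. f x * g x" "\<lambda>x. h x * g x"] by (simp add: distrib_right)
qed

lemma trig_sum_const: "trig_sum (\<lambda>_. c)"
  using trig_sum.character[of c 0] by simp

lemma continuous_on_trig_sum: "trig_sum f \<Longrightarrow> continuous_on S f"
  by (induction rule: trig_sum.induct) (auto intro!: continuous_intros)

text \<open>Stone-Weierstrass for the algebra of real functions that are trigonometric sums once
  embedded into the complex numbers; \<open>sin\<close> alone separates points.\<close>

lemma trig_sum_dense_real:
  assumes "continuous_on {0..1} f" "0 < e"
  obtains g :: "real \<Rightarrow> real" where "trig_sum (\<lambda>x. complex_of_real (g x))" "\<And>x. x \<in> {0..1} \<Longrightarrow> \<bar>f x - g x\<bar> < e"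
proof -
  have "\<exists>g. trig_sum (\<lambda>x. complex_of_real (g x)) \<and> (\<forall>x\<in>{0..1}. \<bar>f x - g x\<bar> < e)"
  proof (rule Stone_Weierstrass_HOL[where S = "{0..1}"])
    fix g :: "real \<Rightarrow> real" assume "trig_sum (\<lambda>x. complex_of_real (g x))"
    then have "continuous_on {0..1} (\<lambda>x. Re (complex_of_real (g x)))"
      by (intro continuous_on_Re continuous_on_trig_sum)
    then show "continuous_on {0..1} g"
      by simp
  next
    fix x y :: real assume xy: "x \<in> {0..1} \<and> y \<in> {0..1} \<and> x \<noteq> y"
    have "(\<lambda>x. complex_of_real (sin x)) = (\<lambda>x. (1 / (2 * \<i>)) * exp (\<i> * complex_of_real (1 * x))
        + (- 1 / (2 * \<i>)) * exp (\<i> * complex_of_real ((- 1) * x)))"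
      by (simp add: fun_eq_iff sin_of_real[symmetric] sin_exp_eq diff_divide_distrib right_diff_distrib)
    then have "trig_sum (\<lambda>x. complex_of_real (sin x))"
      by (metis trig_sum.character trig_sum.add)
    \<comment> \<open>\<open>sin\<close> is injective between \<open>- pi / 2\<close> and
      \<open>pi / 2\<close>, a range that contains \<open>{0..1}\<close> because
      \<open>pi > 3\<close>.\<close>
    moreover have "sin x \<noteq> sin y"
      using xy sin_inj_pi[of x y] pi_gt3 by force
    ultimately show "\<exists>f. trig_sum (\<lambda>x. complex_of_real (f x)) \<and> f x \<noteq> f y"
      by blast
  qed (use assms in \<open>auto intro: trig_sum_const trig_sum.add trig_sum_mult\<close>)
  then show ?thesis
    using that by blast
qed

lemma trig_sum_dense:
  fixes f :: "real \<Rightarrow> complex"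
  assumes f: "continuous_on {0..1} f" and "0 < e"
  obtains g where "trig_sum g" "\<And>x. x \<in> {0..1} \<Longrightarrow> norm (f x - g x) < e"
proof -
  obtain u where u: "trig_sum (\<lambda>x. complex_of_real (u x))" "\<And>x. x \<in> {0..1} \<Longrightarrow> \<bar>Re (f x) - u x\<bar> < e / 2"
    using trig_sum_dense_real[of "\<lambda>x. Re (f x)" "e / 2"] assms by (auto intro: continuous_on_Re)
  obtain v where v: "trig_sum (\<lambda>x. complex_of_real (v x))" "\<And>x. x \<in> {0..1} \<Longrightarrow> \<bar>Im (f x) - v x\<bar> < e / 2"
    using trig_sum_dense_real[of "\<lambda>x. Im (f x)" "e / 2"] assms by (auto intro: continuous_on_Im)
  show ?thesis
  proof (rule that)
    show "trig_sum (\<lambda>x. complex_of_real (u x) + \<i> * complex_of_real (v x))"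
      by (intro trig_sum.add trig_sum_mult trig_sum_const u v)
    show "norm (f x - (complex_of_real (u x) + \<i> * complex_of_real (v x))) < e" if "x \<in> {0..1}" for x
      using cmod_le[of "f x - (complex_of_real (u x) + \<i> * complex_of_real (v x))"] u(2)[OF that] v(2)[OF that]
      by simp
  qed
qed

text \<open>The kernel is the derivative of \<open>arctan (n * (x - a)) / pi\<close>, the Poisson
  kernel of the half-plane, and concentrates at \<open>a\<close>. Its mass on \<open>{0..1}\<close>
  tends to 1 at interior points but only to one half at an endpoint, where
  \<open>\<psi> a = 0\<close> makes the mass irrelevant.\<close>

lemma arctan_kernel_tendsto:
  fixes \<psi> :: "real \<Rightarrow> complex"
  assumes cont: "continuous_on {0..1} \<psi>" and ends: "\<psi> 0 = 0" "\<psi> 1 = 0" and a: "a \<in> {0..1}"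
  shows "(\<lambda>n. integral {0..1} (\<lambda>x. complex_of_real (real n / (pi * (1 + (real n * (x - a))\<^sup>2))) * \<psi> x))
           \<longlonglongrightarrow> \<psi> a"
proof -
  define k where "k n x = real n / (pi * (1 + (real n * (x - a))\<^sup>2))" for n :: nat and x :: real
  define m where "m n = (arctan (real n * (1 - a)) - arctan (real n * (0 - a))) / pi" for n :: nat
  have k_nonneg: "k n x \<ge> 0" for n x
    by (simp add: k_def)
  have cont_k: "continuous_on {0..1} (k n)" for n
    unfolding k_def by (intro continuous_intros) (auto simp: add_nonneg_eq_0_iff)
  have k_int: "(k n has_integral m n) {0..1}" for n
  proof -
    have "((\<lambda>x. arctan (real n * (x - a)) / pi) has_real_derivative k n x) (at x within {0..1})" for x
      unfolding k_def by (rule derivative_eq_intros refl pi_neq_zero | simp add: divide_inverse mult_ac)+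
    then have "(k n has_integral (arctan (real n * (1 - a)) / pi - arctan (real n * (0 - a)) / pi)) {0..1}"
      by (intro fundamental_theorem_of_calculus) (auto simp: has_real_derivative_iff_has_vector_derivative)
    then show ?thesis
      by (simp add: m_def diff_divide_distrib)
  qed
  have m_le: "m n \<le> 1" for n
    using arctan_bounded[of "real n * (1 - a)"] arctan_bounded[of "real n * (0 - a)"]
    by (simp add: m_def field_simps)
  obtain M where M: "M > 0" "\<And>x. x \<in> {0..1} \<Longrightarrow> norm (\<psi> x) \<le> M"
    using compact_imp_bounded[OF compact_continuous_image[OF cont compact_Icc]]
    unfolding bounded_pos by blast
  have "(\<lambda>n. integral {0..1} (\<lambda>x. complex_of_real (k n x) * \<psi> x) - complex_of_real (m n) * \<psi> a) \<longlonglongrightarrow> 0"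
  proof (rule LIMSEQ_I)
    fix e :: real assume "e > 0"
    then obtain \<delta> where "\<delta> > 0" and \<delta>: "\<And>x. x \<in> {0..1} \<Longrightarrow> dist x a < \<delta> \<Longrightarrow> dist (\<psi> x) (\<psi> a) < e / 2"
      using cont a unfolding continuous_on_iff by (metis half_gt_zero)
    \<comment> \<open>Outside the \<open>\<delta>\<close>-neighbourhood
      \<open>C * (x - a)\<^sup>2\<close> dominates the trivial bound \<open>2 * M\<close>, so one
      inequality serves near and far points and the integral need not be split.\<close>
    define C where "C = 2 * M / \<delta>\<^sup>2"
    have "C > 0"
      using M \<open>\<delta> > 0\<close> by (simp add: C_def)
    have close: "norm (\<psi> x - \<psi> a) \<le> e / 2 + C * (x - a)\<^sup>2" if "x \<in> {0..1}" for x
    proof (cases "dist x a < \<delta>")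
      case True
      then show ?thesis
        using \<delta>[OF that] \<open>C > 0\<close> by (simp add: dist_norm add_increasing2 less_imp_le)
    next
      case False
      then have "\<delta>\<^sup>2 \<le> (x - a)\<^sup>2"
        using \<open>\<delta> > 0\<close> by (simp add: dist_real_def abs_le_square_iff[symmetric])
      then have "2 * M \<le> C * (x - a)\<^sup>2"
        using \<open>\<delta> > 0\<close> M by (simp add: C_def field_simps)
      moreover have "norm (\<psi> x - \<psi> a) \<le> 2 * M"
        using norm_triangle_ineq4[of "\<psi> x" "\<psi> a"] M(2)[OF that] M(2)[OF a] by linarith
      ultimately show ?thesis
        using \<open>e > 0\<close> by linarith
    qed
    obtain N :: nat where N: "N > 0" "real N > 2 * C / (e * pi)"
      using reals_Archimedean2[of "max 1 (2 * C / (e * pi))"] by (metis gr0I max_less_iff_conj not_one_less_zero of_nat_0)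
    show "\<exists>no. \<forall>n\<ge>no. norm (integral {0..1} (\<lambda>x. complex_of_real (k n x) * \<psi> x) - complex_of_real (m n) * \<psi> a - 0) < e"
    proof (intro exI[of _ N] allI impI)
      fix n assume "n \<ge> N"
      then have n: "real n > 2 * C / (e * pi)" "n > 0"
        using N by auto
      have "((\<lambda>x. complex_of_real (k n x)) has_integral complex_of_real (m n)) {0..1}"
        using k_int by (rule has_integral_of_real)
      then have "((\<lambda>x. complex_of_real (k n x) * \<psi> a) has_integral complex_of_real (m n) * \<psi> a) {0..1}"
        by (rule has_integral_mult_left)
      moreover have "((\<lambda>x. complex_of_real (k n x) * \<psi> x) has_integral
          integral {0..1} (\<lambda>x. complex_of_real (k n x) * \<psi> x)) {0..1}"
        by (intro integrable_integral integrable_continuous_real continuous_intros cont cont_k)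
      ultimately have D: "((\<lambda>x. complex_of_real (k n x) * \<psi> x - complex_of_real (k n x) * \<psi> a) has_integral
          (integral {0..1} (\<lambda>x. complex_of_real (k n x) * \<psi> x) - complex_of_real (m n) * \<psi> a)) {0..1}"
        by (intro has_integral_diff)
      have bound: "((\<lambda>x. k n x * (e / 2) + C / (n * pi)) has_integral (m n * (e / 2) + C / (n * pi))) {0..1}"
        using has_integral_add[OF has_integral_mult_left[OF k_int, of n "e / 2"] has_integral_const_real[of "C / (n * pi)" 0 1]]
        by simp
      have pw: "norm (complex_of_real (k n x) * \<psi> x - complex_of_real (k n x) * \<psi> a) \<le> k n x * (e / 2) + C / (n * pi)"
        if "x \<in> {0..1}" for x
      proof -
        have "norm (complex_of_real (k n x) * \<psi> x - complex_of_real (k n x) * \<psi> a) = k n x * norm (\<psi> x - \<psi> a)"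
          using k_nonneg by (simp add: right_diff_distrib[symmetric] norm_mult)
        also have "\<dots> \<le> k n x * (e / 2 + C * (x - a)\<^sup>2)"
          using k_nonneg close[OF that] by (intro mult_left_mono)
        also have "\<dots> = k n x * (e / 2) + C * (k n x * (x - a)\<^sup>2)"
          by (simp add: algebra_simps)
        also have "\<dots> \<le> k n x * (e / 2) + C * (1 / (n * pi))"
        proof -
          have pos: "1 + (real n * (x - a))\<^sup>2 > 0"
            by (simp add: add_pos_nonneg)
          \<comment> \<open>The decay of the kernel absorbs the quadratic factor: with
            \<open>y = (n * (x - a))\<^sup>2\<close>, what remains beside
            \<open>1 / (n * pi)\<close> is \<open>y / (1 + y) \<le> 1\<close>.\<close>
          have "k n x * (x - a)\<^sup>2 = (1 / (n * pi)) * ((real n * (x - a))\<^sup>2 / (1 + (real n * (x - a))\<^sup>2))"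
            using n(2) by (simp add: k_def power_mult_distrib power2_eq_square)
          also have "\<dots> \<le> (1 / (n * pi)) * 1"
            using pos by (intro mult_left_mono) auto
          finally have "k n x * (x - a)\<^sup>2 \<le> 1 / (n * pi)"
            by simp
          then show ?thesis
            using \<open>C > 0\<close> by (intro add_left_mono mult_left_mono) auto
        qed
        finally show ?thesis by simp
      qed
      have "norm (integral {0..1} (\<lambda>x. complex_of_real (k n x) * \<psi> x) - complex_of_real (m n) * \<psi> a)
          \<le> m n * (e / 2) + C / (n * pi)"
        using integral_norm_bound_integral[OF has_integral_integrable[OF D] has_integral_integrable[OF bound] pw]
          integral_unique[OF D] integral_unique[OF bound] by simp
      also have "\<dots> < e / 2 + e / 2"
      proof (rule add_le_less_mono)
        show "m n * (e / 2) \<le> e / 2"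
          using m_le[of n] \<open>e > 0\<close> by simp
        show "C / (n * pi) < e / 2"
          using n \<open>e > 0\<close> by (simp add: field_simps)
      qed
      finally show "norm (integral {0..1} (\<lambda>x. complex_of_real (k n x) * \<psi> x) - complex_of_real (m n) * \<psi> a - 0) < e"
        by simp
    qed
  qed
  moreover have "(\<lambda>n. complex_of_real (m n) * \<psi> a) \<longlonglongrightarrow> \<psi> a"
  proof (cases "0 < a \<and> a < 1")
    case True
    have lim: "(\<lambda>n. arctan (real n * c)) \<longlonglongrightarrow> pi / 2" if "c > 0" for c
      using that by (intro filterlim_compose[OF tendsto_arctan_at_top]
          filterlim_at_top_mult_tendsto_pos[OF tendsto_const] filterlim_real_sequentially)
    have "m = (\<lambda>n. (arctan (real n * (1 - a)) + arctan (real n * a)) / pi)"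
      by (simp add: m_def fun_eq_iff flip: arctan_minus)
    moreover have "(\<lambda>n. (arctan (real n * (1 - a)) + arctan (real n * a)) / pi) \<longlonglongrightarrow> (pi / 2 + pi / 2) / pi"
      using True by (intro tendsto_intros lim) auto
    ultimately have "m \<longlonglongrightarrow> (pi / 2 + pi / 2) / pi"
      by simp
    then have "(\<lambda>n. complex_of_real (m n) * \<psi> a) \<longlonglongrightarrow> complex_of_real 1 * \<psi> a"
      by (intro tendsto_intros) simp
    then show ?thesis by simp
  next
    case False
    then have "a = 0 \<or> a = 1"
      using a by auto
    then show ?thesis
      using ends by auto
  qed
  ultimately have "(\<lambda>n. (integral {0..1} (\<lambda>x. complex_of_real (k n x) * \<psi> x) - complex_of_real (m n) * \<psi> a)
      + complex_of_real (m n) * \<psi> a) \<longlonglongrightarrow> 0 + \<psi> a"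
    by (rule tendsto_add)
  then show ?thesis
    by (simp add: k_def)
qed

section \<open>Approximating the conjugate measure\<close>

text \<open>Tagging every interval by its left endpoint gives a tagged division, to which
  \<open>additive_tagged_division_1\<close> applies; the tagging is injective, so the sum
  reindexes.\<close>

lemma division_telescope:
  fixes f :: "real \<Rightarrow> 'a::real_normed_vector"
  assumes "a \<le> b" and d: "d division_of {a..b}"
  shows "(\<Sum>K\<in>d. f (Sup K) - f (Inf K)) = f b - f a"
proof -
  define p where "p = (\<lambda>K. (Inf K, K)) ` d"
  have "p tagged_division_of {a..b}"
  proof (rule tagged_division_ofI)
    show "finite p"
      using division_ofD(1)[OF d] by (simp add: p_def)
    show "\<Union>{K. \<exists>x. (x, K) \<in> p} = {a..b}"
    proof -
      have "{K. \<exists>x. (x, K) \<in> p} = d"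
        by (auto simp: p_def)
      then show ?thesis
        using division_ofD(6)[OF d] by simp
    qed
    fix x K assume "(x, K) \<in> p"
    then have K: "K \<in> d" "x = Inf K"
      by (auto simp: p_def)
    then obtain u v where uv: "K = cbox u v"
      using division_ofD(4)[OF d] by blast
    moreover have "K \<noteq> {}"
      using division_ofD(3)[OF d] K by blast
    ultimately show "x \<in> K"
      using K by auto
    show "K \<subseteq> {a..b}"
      using division_ofD(2)[OF d] K by blast
    show "\<exists>u v. K = cbox u v"
      using uv by blast
    fix y L assume "(y, L) \<in> p" "(x, K) \<noteq> (y, L)"
    then have "L \<in> d" "K \<noteq> L"
      using K by (auto simp: p_def)
    then show "interior K \<inter> interior L = {}"
      using division_ofD(5)[OF d] K by blast
  qed
  then have "(\<Sum>z\<in>p. f (Sup (snd z)) - f (Inf (snd z))) = f b - f a"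
    using additive_tagged_division_1[OF \<open>a \<le> b\<close>, of p f] by (simp add: case_prod_unfold)
  then show ?thesis
    unfolding p_def by (subst (asm) sum.reindex) (auto intro: inj_onI)
qed

text \<open>An interval can carry two tags only if its interior is empty. It is then a single point
  with zero increment, so passing to the set of intervals does not change the sum.\<close>

lemma tagged_division_variation_le:
  fixes f :: "real \<Rightarrow> 'a::real_normed_vector"
  assumes V: "\<And>d. d division_of {a..b} \<Longrightarrow> (\<Sum>K\<in>d. norm (f (Sup K) - f (Inf K))) \<le> V"
    and p: "p tagged_division_of {a..b}"
  shows "(\<Sum>z\<in>p. norm (f (Sup (snd z)) - f (Inf (snd z)))) \<le> V"
proof -
  define g where "g K = (if K = {} then 0 else norm (f (Sup K) - f (Inf K)))" for K :: "real set"
  have ne: "K \<noteq> {}" if "K \<in> snd ` p" for K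
    using division_ofD(3)[OF division_of_tagged_division[OF p] that] .
  have "(\<Sum>z\<in>p. norm (f (Sup (snd z)) - f (Inf (snd z)))) = (\<Sum>z\<in>p. g (snd z))"
    using ne by (intro sum.cong) (auto simp: g_def)
  also have "\<dots> = (\<Sum>(_, K)\<in>p. g K)"
    by (simp add: case_prod_unfold)
  also have "\<dots> = sum g (snd ` p)"
  proof (rule sum.over_tagged_division_lemma[OF p])
    fix u v :: real
    assume "box u v = {}"
    then show "g (cbox u v) = 0"
      by (cases "u = v") (auto simp: g_def)
  qed
  also have "\<dots> = (\<Sum>K\<in>snd ` p. norm (f (Sup K) - f (Inf K)))"
    using ne by (intro sum.cong) (auto simp: g_def)
  also have "\<dots> \<le> V"
    using V division_of_tagged_division[OF p] by blast
  finally show ?thesis .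
qed

text \<open>On each interval of the division the integrand is roughly the conjugate phase of the increment
  of \<open>\<psi>\<close>, with the steps smoothed by \<open>arctan\<close>. Monotonicity of \<open>arctan\<close> makes the weights of the
  phases nonnegative, and they telescope to at most 1, which gives \<open>\<bar>f\<bar> \<le> 1\<close>.\<close>
lemma RS_integral_near_variation:
  fixes \<psi> :: "real \<Rightarrow> complex"
  assumes cont: "continuous_on {0..1} \<psi>" and ends: "\<psi> 0 = 0" "\<psi> 1 = 0"
    and d: "d division_of {0..1}" and c: "c < (\<Sum>K\<in>d. norm (\<psi> (Sup K) - \<psi> (Inf K)))"
  obtains f I where "continuous_on {0..1} f" "\<And>x. norm (f x) \<le> 1"
    "has_RS_integral f \<psi> 0 1 I" "c < Re I"
proof -
  define u where "u K = cnj (sgn (\<psi> (Sup K) - \<psi> (Inf K)))" for K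
  \<comment> \<open>For large \<open>n\<close> this is a smoothed step from -1/2 to 1/2, so
    \<open>\<phi> n (x - Inf K) - \<phi> n (x - Sup K)\<close> approximates the indicator function
    of \<open>K\<close>.\<close>
  define \<phi> where "\<phi> n y = arctan (real n * y) / pi" for n :: nat and y :: real
  define f where "f n x = (\<Sum>K\<in>d. u K * complex_of_real (\<phi> n (x - Inf K) - \<phi> n (x - Sup K)))" for n x
  \<comment> \<open>The integral of \<open>\<phi> n (x - a)\<close> against \<open>\<psi>\<close>
    after integration by parts, whose boundary terms vanish with \<open>\<psi>\<close> at 0 and 1.
    It tends to \<open>- \<psi> a\<close> by the kernel lemma.\<close>
  define J where "J n a = - integral {0..1}
    (\<lambda>x. complex_of_real (real n / (pi * (1 + (real n * (x - a))\<^sup>2))) * \<psi> x)" for n :: nat and a :: real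
  define I where "I n = (\<Sum>K\<in>d. u K * (J n (Inf K) - J n (Sup K)))" for n
  have fin: "finite d"
    using d by (rule division_ofD(1))
  have K: "0 \<le> Inf K \<and> Inf K \<le> Sup K \<and> Sup K \<le> 1" if "K \<in> d" for K
  proof -
    obtain r s where "K = cbox r s"
      using division_ofD(4)[OF d \<open>K \<in> d\<close>] by blast
    moreover have "K \<noteq> {}" "K \<subseteq> {0..1}"
      using division_ofD(2,3)[OF d \<open>K \<in> d\<close>] by auto
    ultimately show ?thesis by auto
  qed
  have mono: "\<phi> n x \<le> \<phi> n y" if "x \<le> y" for n x y
    using that by (auto simp: \<phi>_def divide_right_mono arctan_le_iff mult_left_mono)
  have "norm (u K) \<le> 1" for K
    by (simp add: u_def norm_sgn)
  have norm_f: "norm (f n x) \<le> 1" for n x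
  proof -
    have "norm (f n x) \<le> (\<Sum>K\<in>d. \<phi> n (x - Inf K) - \<phi> n (x - Sup K))"
      unfolding f_def
    proof (rule sum_norm_le)
      fix L assume "L \<in> d"
      then have "\<phi> n (x - Sup L) \<le> \<phi> n (x - Inf L)"
        using K by (intro mono) simp
      then have "norm (u L * complex_of_real (\<phi> n (x - Inf L) - \<phi> n (x - Sup L)))
          = norm (u L) * (\<phi> n (x - Inf L) - \<phi> n (x - Sup L))"
        by (simp only: norm_mult norm_of_real)
      also have "\<dots> \<le> 1 * (\<phi> n (x - Inf L) - \<phi> n (x - Sup L))"
        using \<open>norm (u L) \<le> 1\<close> \<open>\<phi> n (x - Sup L) \<le> \<phi> n (x - Inf L)\<close> by (intro mult_right_mono) auto
      finally show "norm (u L * complex_of_real (\<phi> n (x - Inf L) - \<phi> n (x - Sup L)))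
          \<le> \<phi> n (x - Inf L) - \<phi> n (x - Sup L)"
        by simp
    qed
    also have "\<dots> = \<phi> n x - \<phi> n (x - 1)"
      using division_telescope[OF zero_le_one d, of "\<lambda>s. - \<phi> n (x - s)"] by simp
    also have "\<dots> \<le> 1"
      using arctan_bounded[of "real n * x"] arctan_bounded[of "real n * (x - 1)"]
      by (simp add: \<phi>_def field_simps)
    finally show ?thesis .
  qed
  have cont_\<phi>: "continuous_on S (\<lambda>x. \<phi> n (x - a))" for S n a
    unfolding \<phi>_def by (intro continuous_intros) auto
  have cont_f: "continuous_on {0..1} (f n)" for n
    unfolding f_def by (intro continuous_intros cont_\<phi>)
  have RS_\<phi>: "has_RS_integral (\<lambda>x. complex_of_real (\<phi> n (x - a))) \<psi> 0 1 (J n a)" for n a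
  proof -
    define k where "k x = real n / (pi * (1 + (real n * (x - a))\<^sup>2))" for x
    have "((\<lambda>x. \<phi> n (x - a)) has_real_derivative k x) (at x within {0..1})" for x
      unfolding k_def \<phi>_def by (rule derivative_eq_intros refl pi_neq_zero | simp add: divide_inverse mult_ac)+
    then have deriv: "((\<lambda>x. complex_of_real (\<phi> n (x - a))) has_vector_derivative complex_of_real (k x))
        (at x within {0..1})" for x
      by (rule has_vector_derivative_of_real)
    have "continuous_on {0..1} (\<lambda>x. complex_of_real (k x))"
      unfolding k_def by (intro continuous_intros) (auto simp: add_nonneg_eq_0_iff)
    from has_RS_integral_by_parts[OF zero_le_one cont this deriv]
    show ?thesis
      by (simp add: J_def k_def ends)
  qed
  have RS_f: "has_RS_integral (f n) \<psi> 0 1 (I n)" for n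
    unfolding f_def I_def
  proof (intro has_RS_integral_sum fin)
    fix K
    have "has_RS_integral (\<lambda>x. u K * complex_of_real (\<phi> n (x - Inf K)) + (- u K) * complex_of_real (\<phi> n (x - Sup K)))
        \<psi> 0 1 (u K * J n (Inf K) + (- u K) * J n (Sup K))"
      by (intro has_RS_integral_add has_RS_integral_mult_left RS_\<phi>)
    then show "has_RS_integral (\<lambda>x. u K * complex_of_real (\<phi> n (x - Inf K) - \<phi> n (x - Sup K))) \<psi> 0 1
        (u K * (J n (Inf K) - J n (Sup K)))"
      by (simp add: right_diff_distrib)
  qed
  \<comment> \<open>In the limit each \<open>K\<close> contributes \<open>u K\<close> times the
    increment of \<open>\<psi>\<close> over \<open>K\<close>. The conjugate phase turns this into
    the modulus, so the variation sum of \<open>d\<close> appears.\<close>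
  have "I \<longlonglongrightarrow> (\<Sum>K\<in>d. u K * ((- \<psi> (Inf K)) - (- \<psi> (Sup K))))"
    unfolding I_def
  proof (intro tendsto_sum tendsto_mult_left tendsto_diff)
    fix L assume "L \<in> d"
    then show "(\<lambda>n. J n (Inf L)) \<longlonglongrightarrow> - \<psi> (Inf L)" "(\<lambda>n. J n (Sup L)) \<longlonglongrightarrow> - \<psi> (Sup L)"
      unfolding J_def using K[of L]
      by (intro tendsto_minus arctan_kernel_tendsto[OF cont ends]; simp)+
  qed
  also have "(\<Sum>K\<in>d. u K * ((- \<psi> (Inf K)) - (- \<psi> (Sup K))))
      = complex_of_real (\<Sum>K\<in>d. norm (\<psi> (Sup K) - \<psi> (Inf K)))"
  proof -
    have "cnj (sgn z) * z = complex_of_real (norm z)" for z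
      by (cases "z = 0") (simp_all add: sgn_eq complex_norm_square[symmetric] power2_eq_square mult.commute)
    then show ?thesis
      by (simp add: u_def)
  qed
  finally have "(\<lambda>n. Re (I n)) \<longlonglongrightarrow> Re (complex_of_real (\<Sum>K\<in>d. norm (\<psi> (Sup K) - \<psi> (Inf K))))"
    by (rule tendsto_Re)
  then have "(\<lambda>n. Re (I n)) \<longlonglongrightarrow> (\<Sum>K\<in>d. norm (\<psi> (Sup K) - \<psi> (Inf K)))"
    by (simp only: Re_complex_of_real)
  then have "eventually (\<lambda>n. c < Re (I n)) sequentially"
    using c by (rule order_tendstoD)
  then obtain n where "c < Re (I n)"
    by (metis eventually_happens trivial_limit_sequentially)
  then show ?thesis
    using that cont_f norm_f RS_f by blast
qed

text \<open>The defect \<open>\<bar>z\<bar> - Re (f z)\<close> bounds both \<open>1 - \<bar>f\<bar>\<close> and, through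
  \<open>(Im (f z))\<^sup>2 \<le> (\<bar>z\<bar> - Re (f z)) (\<bar>z\<bar> + Re (f z))\<close> and AM-GM with parameter \<open>\<kappa>\<close>, the imaginary part
  of \<open>f z\<close>. A product form of this bound would need Cauchy--Schwarz after summation.\<close>
lemma norm_cnj_minus_le:
  fixes f z :: complex
  assumes f: "norm f \<le> 1" and "0 < \<kappa>"
  shows "norm (cnj z - f\<^sup>2 * z) \<le> (2 + 1 / \<kappa>) * (norm z - Re (f * z)) + 2 * \<kappa> * norm z"
proof -
  define w where "w = f * z"
  have w_le: "norm w \<le> norm f * norm z" "norm w \<le> norm z"
    using f by (simp_all add: w_def norm_mult mult_left_le_one_le)
  define A where "A = norm z - Re w"
  define B where "B = norm z + Re w"
  have AB: "A \<ge> 0" "B \<ge> 0" "B \<le> 2 * norm z"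
    using w_le abs_Re_le_cmod[of w] by (auto simp: A_def B_def)
  have "(Im w)\<^sup>2 \<le> A * B"
  proof -
    have "(Re w)\<^sup>2 + (Im w)\<^sup>2 \<le> (norm z)\<^sup>2"
      using power_mono[OF w_le(2) norm_ge_zero, of 2] by (simp add: cmod_power2)
    then show ?thesis
      by (simp add: A_def B_def power2_eq_square algebra_simps)
  qed
  also have "A * B \<le> ((A / \<kappa> + \<kappa> * B) / 2)\<^sup>2"
  proof -
    have "((A / \<kappa> + \<kappa> * B) / 2)\<^sup>2 - A * B = ((A / \<kappa> - \<kappa> * B) / 2)\<^sup>2"
      using \<open>0 < \<kappa>\<close> by (simp add: power2_eq_square field_simps)
    then show ?thesis
      by (metis diff_ge_0_iff_ge zero_le_power2)
  qed
  finally have "\<bar>Im w\<bar> \<le> \<bar>(A / \<kappa> + \<kappa> * B) / 2\<bar>"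
    by (simp only: abs_le_square_iff)
  also have "\<dots> = (A / \<kappa> + \<kappa> * B) / 2"
    using AB \<open>0 < \<kappa>\<close> by simp
  finally have "2 * \<bar>Im w\<bar> \<le> A / \<kappa> + \<kappa> * B"
    by simp
  also have "\<dots> \<le> A / \<kappa> + 2 * \<kappa> * norm z"
    using mult_left_mono[OF AB(3), of \<kappa>] \<open>0 < \<kappa>\<close> by (simp add: mult_ac)
  finally have Im: "2 * \<bar>Im w\<bar> \<le> A / \<kappa> + 2 * \<kappa> * norm z" .
  \<comment> \<open>Because \<open>f * cnj w = (norm f)\<^sup>2 * cnj z\<close>, this separates two
    defects: how far \<open>norm f\<close> is from 1, and how far \<open>w\<close> is from being
    real.\<close>
  have "cnj z - f\<^sup>2 * z = (1 - complex_of_real ((norm f)\<^sup>2)) * cnj z - f * (w - cnj w)"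
    unfolding complex_norm_square by (simp add: w_def power2_eq_square algebra_simps)
  also have "norm \<dots> \<le> norm ((1 - complex_of_real ((norm f)\<^sup>2)) * cnj z) + norm (f * (w - cnj w))"
    by (rule norm_triangle_ineq4)
  also have "norm (f * (w - cnj w)) \<le> 2 * \<bar>Im w\<bar>"
    using f by (simp add: norm_mult complex_diff_cnj mult_left_le_one_le)
  also have "norm ((1 - complex_of_real ((norm f)\<^sup>2)) * cnj z) \<le> 2 * A"
  proof -
    have "(norm f)\<^sup>2 \<le> 1"
      using f by (simp add: power_le_one)
    then have "norm (1 - complex_of_real ((norm f)\<^sup>2)) = 1 - (norm f)\<^sup>2"
      by (metis abs_of_nonneg diff_ge_0_iff_ge norm_of_real of_real_1 of_real_diff)
    also have "\<dots> = (1 + norm f) * (1 - norm f)"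
      by (simp add: power2_eq_square algebra_simps)
    also have "\<dots> \<le> 2 * (1 - norm f)"
      using f by (intro mult_right_mono) auto
    finally have "norm ((1 - complex_of_real ((norm f)\<^sup>2)) * cnj z) \<le> 2 * (1 - norm f) * norm z"
      by (simp add: norm_mult mult_right_mono)
    \<comment> \<open>Uses the chain \<open>Re w \<le> norm w \<le> norm f * norm z\<close>.\<close>
    also have "\<dots> \<le> 2 * A"
      using w_le abs_Re_le_cmod[of w] by (simp add: A_def algebra_simps)
    finally show ?thesis .
  qed
  finally have "norm (cnj z - f\<^sup>2 * z) \<le> (2 + 1 / \<kappa>) * A + 2 * \<kappa> * norm z"
    using Im by (simp add: distrib_right)
  then show ?thesis
    by (simp only: A_def w_def)
qed

text \<open>The conjugate of the measure is approximated by \<open>g\<close> times the measure in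
  total variation. Bounding the sum of norms, not the norm of the sum, lets the estimate survive
  multiplication by any character. The error has three shares of \<open>e / 3\<close>: two from
  \<open>norm_cnj_minus_le\<close>, one from replacing the square of \<open>f\<close> by
  \<open>g\<close>.\<close>

lemma cnj_increments_approx:
  fixes \<psi> :: "real \<Rightarrow> complex"
  assumes cont: "continuous_on {0..1} \<psi>" and bv: "bounded_variation_on \<psi> 0 1"
    and ends: "\<psi> 0 = 0" "\<psi> 1 = 0" and "0 < e"
  obtains g where "trig_sum g"
    "eventually (\<lambda>p. (\<Sum>z\<in>p. norm (cnj (\<psi> (Sup (snd z)) - \<psi> (Inf (snd z)))
        - g (fst z) * (\<psi> (Sup (snd z)) - \<psi> (Inf (snd z))))) \<le> e) (mesh_filter 0 1)"
proof -
  define S where "S = (\<lambda>d. \<Sum>K\<in>d. norm (\<psi> (Sup K) - \<psi> (Inf K))) ` {d. d division_of {0..1}}"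
  define V where "V = Sup S"
  have "bdd_above S"
    using bv by (auto simp: S_def bounded_variation_on_def bdd_above_def)
  have "S \<noteq> {}"
    using elementary_interval[of "0::real" 1] by (auto simp: S_def)
  have V: "(\<Sum>K\<in>d. norm (\<psi> (Sup K) - \<psi> (Inf K))) \<le> V" if "d division_of {0..1}" for d
    unfolding V_def using that by (intro cSup_upper \<open>bdd_above S\<close>) (auto simp: S_def)
  have "V \<ge> 0"
  proof -
    obtain d :: "real set set" where "d division_of {0..1}"
      using elementary_interval[of "0::real" 1] by auto
    from V[OF this] show ?thesis
      by (rule order_trans[rotated]) (simp add: sum_nonneg)
  qed
  \<comment> \<open>\<open>V + 1\<close> instead of \<open>V\<close> keeps the quotient meaningful
    when the variation is 0; \<open>\<theta>\<close> times the variation is at most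
    \<open>e / 3\<close>.\<close>
  define \<theta> where "\<theta> = e / (3 * (V + 1))"
  have "\<theta> > 0"
    using \<open>V \<ge> 0\<close> \<open>0 < e\<close> by (simp add: \<theta>_def)
  \<comment> \<open>Chosen so that the term \<open>2 * \<kappa> * norm z\<close> of
    \<open>norm_cnj_minus_le\<close> costs as much as the approximation by \<open>g\<close>.\<close>
  define \<kappa> where "\<kappa> = \<theta> / 2"
  have two_\<kappa>: "2 * \<kappa> = \<theta>" and "\<kappa> > 0"
    using \<open>\<theta> > 0\<close> by (simp_all add: \<kappa>_def)
  define C where "C = 2 + 1 / \<kappa>"
  have "C > 0"
    using \<open>\<kappa> > 0\<close> by (simp add: C_def add_pos_pos)
  \<comment> \<open>The defect gets multiplied by \<open>C\<close>, which grows as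
    \<open>\<kappa>\<close> shrinks, so the required closeness to the total variation is fixed only
    after \<open>\<kappa>\<close>.\<close>
  define \<eta> where "\<eta> = e / 3 / C"
  have "\<eta> > 0"
    using \<open>C > 0\<close> \<open>0 < e\<close> by (simp add: \<eta>_def)
  obtain d where d: "d division_of {0..1}" "V - \<eta> < (\<Sum>K\<in>d. norm (\<psi> (Sup K) - \<psi> (Inf K)))"
    using less_cSup_iff[OF \<open>S \<noteq> {}\<close> \<open>bdd_above S\<close>, of "V - \<eta>"] \<open>\<eta> > 0\<close> by (auto simp: V_def S_def)
  obtain f I where f: "continuous_on {0..1} f" "\<And>x. norm (f x) \<le> 1"
    and I: "has_RS_integral f \<psi> 0 1 I" "V - \<eta> < Re I"
    using RS_integral_near_variation[OF cont ends d] by blast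
  obtain g where g: "trig_sum g" "\<And>x. x \<in> {0..1} \<Longrightarrow> norm ((f x)\<^sup>2 - g x) < \<theta>"
    using trig_sum_dense[of "\<lambda>x. (f x)\<^sup>2" "\<theta>"] f \<open>\<theta> > 0\<close>
    by (auto intro: continuous_on_power)
  show ?thesis
  proof (rule that[OF g(1)])
    have "((\<lambda>p. Re (RS_sum f \<psi> p)) \<longlongrightarrow> Re I) (mesh_filter 0 1)"
      using I(1) unfolding has_RS_integral_iff_tendsto by (rule tendsto_Re)
    then have "eventually (\<lambda>p. V - \<eta> < Re (RS_sum f \<psi> p)) (mesh_filter 0 1)"
      using I(2) by (rule order_tendstoD)
    with eventually_mesh_tagged_division
    show "eventually (\<lambda>p. (\<Sum>z\<in>p. norm (cnj (\<psi> (Sup (snd z)) - \<psi> (Inf (snd z)))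
        - g (fst z) * (\<psi> (Sup (snd z)) - \<psi> (Inf (snd z))))) \<le> e) (mesh_filter 0 1)"
    proof eventually_elim
      case (elim p)
      define \<Delta> where "\<Delta> z = \<psi> (Sup (snd z)) - \<psi> (Inf (snd z))" for z :: "real \<times> real set"
      have var: "(\<Sum>z\<in>p. norm (\<Delta> z)) \<le> V"
        unfolding \<Delta>_def using V elim(1) by (rule tagged_division_variation_le)
      \<comment> \<open>The norms sum to at most \<open>V\<close> and the real parts to more than
        \<open>V - \<eta>\<close>.\<close>
      have "(\<Sum>z\<in>p. norm (\<Delta> z) - Re (f (fst z) * \<Delta> z)) \<le> \<eta>"
        using var elim(2) by (simp add: sum_subtractf RS_sum_def \<Delta>_def)
      then have defect: "C * (\<Sum>z\<in>p. norm (\<Delta> z) - Re (f (fst z) * \<Delta> z)) \<le> e / 3"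
        using \<open>C > 0\<close> unfolding \<eta>_def by (simp only: pos_le_divide_eq mult.commute)
      have scale: "\<theta> * (\<Sum>z\<in>p. norm (\<Delta> z)) \<le> e / 3"
      proof -
        have "\<theta> * (\<Sum>z\<in>p. norm (\<Delta> z)) \<le> \<theta> * (V + 1)"
          using var \<open>\<theta> > 0\<close> by (intro mult_left_mono) auto
        also have "\<dots> = e / 3"
          using \<open>V \<ge> 0\<close> by (simp add: \<theta>_def divide_simps)
        finally show ?thesis .
      qed
      have "(\<Sum>z\<in>p. norm (cnj (\<Delta> z) - g (fst z) * \<Delta> z))
          \<le> (\<Sum>z\<in>p. (C * (norm (\<Delta> z) - Re (f (fst z) * \<Delta> z)) + 2 * \<kappa> * norm (\<Delta> z))
                + \<theta> * norm (\<Delta> z))"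
      proof (rule sum_mono)
        fix z assume "z \<in> p"
        then have "fst z \<in> {0..1}"
          using elim(1) by (auto elim: tagged_division_of_realE)
        then have "norm (((f (fst z))\<^sup>2 - g (fst z)) * \<Delta> z) \<le> \<theta> * norm (\<Delta> z)"
          unfolding norm_mult using g(2) by (intro mult_right_mono) (auto simp: less_imp_le)
        moreover have "cnj (\<Delta> z) - g (fst z) * \<Delta> z
            = (cnj (\<Delta> z) - (f (fst z))\<^sup>2 * \<Delta> z) + ((f (fst z))\<^sup>2 - g (fst z)) * \<Delta> z"
          by (simp add: algebra_simps)
        ultimately show "norm (cnj (\<Delta> z) - g (fst z) * \<Delta> z)
            \<le> (C * (norm (\<Delta> z) - Re (f (fst z) * \<Delta> z)) + 2 * \<kappa> * norm (\<Delta> z))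
                + \<theta> * norm (\<Delta> z)"
          using norm_cnj_minus_le[OF f(2) \<open>\<kappa> > 0\<close>, folded C_def]
          by (simp only:) (rule norm_triangle_mono)
      qed
      also have "\<dots> = C * (\<Sum>z\<in>p. norm (\<Delta> z) - Re (f (fst z) * \<Delta> z))
          + 2 * \<kappa> * (\<Sum>z\<in>p. norm (\<Delta> z)) + \<theta> * (\<Sum>z\<in>p. norm (\<Delta> z))"
        by (simp only: sum.distrib sum_distrib_left)
      also have "\<dots> \<le> e / 3 + e / 3 + e / 3"
        unfolding two_\<kappa> by (intro add_mono defect scale)
      finally show ?case
        by (simp add: \<Delta>_def)
    qed
  qed
qed

section \<open>Decay of the Fourier-Stieltjes transform at both ends\<close>

lemma has_RS_integral_character:
  fixes \<psi> :: "real \<Rightarrow> complex"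
  assumes "continuous_on {0..1} \<psi>" "\<psi> 0 = 0" "\<psi> 1 = 0"
  shows "has_RS_integral (\<lambda>x. exp (\<i> * complex_of_real (t * x))) \<psi> 0 1
           (- \<i> * complex_of_real t * fourier01 \<psi> t)"
proof -
  have "((\<lambda>x. exp (\<i> * complex_of_real (t * x))) has_vector_derivative
      \<i> * complex_of_real t * exp (\<i> * complex_of_real (t * x))) (at x within {0..1})" for x
  proof -
    have "((\<lambda>x. exp (\<i> * complex_of_real t * x)) has_field_derivative
        \<i> * complex_of_real t * exp (\<i> * complex_of_real t * complex_of_real x)) (at (complex_of_real x))"
      by (auto intro!: derivative_eq_intros)
    from has_vector_derivative_real_field[OF this] show ?thesis
      by (simp add: mult.assoc)
  qed
  then have "has_RS_integral (\<lambda>x. exp (\<i> * complex_of_real (t * x))) \<psi> 0 1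
      (exp (\<i> * complex_of_real (t * 1)) * \<psi> 1 - exp (\<i> * complex_of_real (t * 0)) * \<psi> 0
        - integral {0..1} (\<lambda>x. \<i> * complex_of_real t * exp (\<i> * complex_of_real (t * x)) * \<psi> x))"
    using assms by (intro has_RS_integral_by_parts) (auto intro!: continuous_intros)
  also have "integral {0..1} (\<lambda>x. \<i> * complex_of_real t * exp (\<i> * complex_of_real (t * x)) * \<psi> x)
      = \<i> * complex_of_real t * fourier01 \<psi> t"
    unfolding fourier01_def mult.assoc by (simp only: integral_mult_right)
  finally show ?thesis
    using assms by simp
qed

text \<open>Multiplying by a character shifts \<open>\<Psi>\<close> by a fixed frequency, which
  preserves decay at \<open>at_top\<close>; linearity does the rest. The witness \<open>F\<close>
  delivers existence of the integrals together with their decay.\<close>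

lemma trig_sum_RS_decay:
  assumes \<Psi>: "\<And>t. has_RS_integral (\<lambda>x. exp (\<i> * complex_of_real (t * x))) \<psi> a b (\<Psi> t)"
    and lim: "(\<Psi> \<longlongrightarrow> 0) at_top" and "trig_sum g"
  shows "\<exists>F. (\<forall>t. has_RS_integral (\<lambda>x. exp (\<i> * complex_of_real (t * x)) * g x) \<psi> a b (F t))
            \<and> (F \<longlongrightarrow> 0) at_top"
  using \<open>trig_sum g\<close>
proof (induction rule: trig_sum.induct)
  case (character c \<theta>)
  show ?case
  proof (intro exI[of _ "\<lambda>t. c * \<Psi> (t + \<theta>)"] conjI allI)
    fix t
    have "(\<lambda>x. exp (\<i> * complex_of_real (t * x)) * (c * exp (\<i> * complex_of_real (\<theta> * x))))
        = (\<lambda>x. c * exp (\<i> * complex_of_real ((t + \<theta>) * x)))"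
      by (simp add: fun_eq_iff distrib_left distrib_right exp_add)
    then show "has_RS_integral (\<lambda>x. exp (\<i> * complex_of_real (t * x)) * (c * exp (\<i> * complex_of_real (\<theta> * x))))
        \<psi> a b (c * \<Psi> (t + \<theta>))"
      using has_RS_integral_mult_left[OF \<Psi>[of "t + \<theta>"]] by simp
    have "filterlim (\<lambda>t. \<theta> + t) at_top at_top"
      by (intro filterlim_tendsto_add_at_top[OF tendsto_const] filterlim_ident)
    then show "((\<lambda>t. c * \<Psi> (t + \<theta>)) \<longlongrightarrow> 0) at_top"
      using filterlim_compose[OF lim] by (intro tendsto_mult_right_zero) (simp add: add.commute)
  qed
next
  case (add f g)
  then obtain F G where
    "\<And>t. has_RS_integral (\<lambda>x. exp (\<i> * complex_of_real (t * x)) * f x) \<psi> a b (F t)" "(F \<longlongrightarrow> 0) at_top"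
    "\<And>t. has_RS_integral (\<lambda>x. exp (\<i> * complex_of_real (t * x)) * g x) \<psi> a b (G t)" "(G \<longlongrightarrow> 0) at_top"
    by blast
  then show ?case
    by (intro exI[of _ "\<lambda>t. F t + G t"]) (auto simp: distrib_left intro: has_RS_integral_add tendsto_add_zero)
qed

theorem theorem2:
  fixes \<psi> :: "real \<Rightarrow> complex"
  assumes cont: "continuous_on {0..1} \<psi>"
    and bv: "bounded_variation_on \<psi> 0 1"
    and ends: "\<psi> 0 = 0" "\<psi> 1 = 0"
    and L2: "set_integrable lborel {0<..<1} (\<lambda>x. (norm (\<psi> x / complex_of_real x))^2)"
    and L1: "\<And>m. m \<le> 2 \<Longrightarrow>
               set_integrable lborel {1..} (\<lambda>t. complex_of_real (t ^ m) * nth_deriv m (fourier01 \<psi>) t)"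
    and small: "\<And>m. 1 \<le> m \<Longrightarrow> m \<le> 2 \<Longrightarrow>
               ((\<lambda>t. complex_of_real (t ^ m) * nth_deriv (m - 1) (fourier01 \<psi>) t) \<longlongrightarrow> 0) at_top"
  shows "(fourier_stieltjes01 \<psi> \<longlongrightarrow> 0) at_infinity"
proof -
  define \<Psi> where "\<Psi> = fourier_stieltjes01 \<psi>"
  have \<Psi>_eq: "\<Psi> t = - \<i> * complex_of_real t * fourier01 \<psi> t" for t
    unfolding \<Psi>_def fourier_stieltjes01_def
    by (rule RS_integral_eqI[OF has_RS_integral_character[OF cont ends]])
  have \<Psi>: "has_RS_integral (\<lambda>x. exp (\<i> * complex_of_real (t * x))) \<psi> 0 1 (\<Psi> t)" for t
    unfolding \<Psi>_eq by (rule has_RS_integral_character[OF cont ends])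
  \<comment> \<open>For \<open>m = 1\<close> the derivative in \<open>small\<close> has order 0, so
    the hypothesis speaks of \<open>t * fourier01 \<psi> t\<close> itself.\<close>
  have "((\<lambda>t. - \<i> * (complex_of_real t * fourier01 \<psi> t)) \<longlongrightarrow> 0) at_top"
    using small[of 1] by (intro tendsto_mult_right_zero) (simp add: nth_deriv_def)
  then have top: "(\<Psi> \<longlongrightarrow> 0) at_top"
    by (simp add: \<Psi>_eq[abs_def] mult.assoc)
  have "((\<lambda>t. \<Psi> (- t)) \<longlongrightarrow> 0) at_top"
  proof (rule tendstoI)
    fix e :: real assume "e > 0"
    then have half: "e / 2 > 0" by simp
    obtain g where g: "trig_sum g" and close:
      "eventually (\<lambda>p. (\<Sum>z\<in>p. norm (cnj (\<psi> (Sup (snd z)) - \<psi> (Inf (snd z)))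
        - g (fst z) * (\<psi> (Sup (snd z)) - \<psi> (Inf (snd z))))) \<le> e / 2) (mesh_filter 0 1)"
      by (rule cnj_increments_approx[OF cont bv ends half])
    obtain F where F: "\<And>t. has_RS_integral (\<lambda>x. exp (\<i> * complex_of_real (t * x)) * g x) \<psi> 0 1 (F t)"
      and F_lim: "(F \<longlongrightarrow> 0) at_top"
      using trig_sum_RS_decay[OF \<Psi> top g] by blast
    \<comment> \<open>\<open>cnj (\<Psi> (- t))\<close> is the transform at \<open>t\<close> of the
      conjugate measure. Characters have modulus 1, so the variation bound carries over with one
      constant for all \<open>t\<close>.\<close>
    have diff: "norm (cnj (\<Psi> (- t)) - F t) \<le> e / 2" for t
    proof (rule tendsto_upperbound)
      let ?E = "\<lambda>x. exp (\<i> * complex_of_real (t * x))"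
      have "has_RS_integral ?E (\<lambda>x. cnj (\<psi> x)) 0 1 (cnj (\<Psi> (- t)))"
        using has_RS_integral_cnj[OF \<Psi>[of "- t"]] by (simp add: exp_cnj)
      then show "((\<lambda>p. norm (RS_sum ?E (\<lambda>x. cnj (\<psi> x)) p - RS_sum (\<lambda>x. ?E x * g x) \<psi> p))
          \<longlongrightarrow> norm (cnj (\<Psi> (- t)) - F t)) (mesh_filter 0 1)"
        using F[of t] unfolding has_RS_integral_iff_tendsto by (intro tendsto_intros)
      show "eventually (\<lambda>p. norm (RS_sum ?E (\<lambda>x. cnj (\<psi> x)) p - RS_sum (\<lambda>x. ?E x * g x) \<psi> p) \<le> e / 2)
          (mesh_filter 0 1)"
        using close
      proof eventually_elim
        case (elim p)
        have "RS_sum ?E (\<lambda>x. cnj (\<psi> x)) p - RS_sum (\<lambda>x. ?E x * g x) \<psi> p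
          = (\<Sum>z\<in>p. ?E (fst z) * (cnj (\<psi> (Sup (snd z)) - \<psi> (Inf (snd z)))
              - g (fst z) * (\<psi> (Sup (snd z)) - \<psi> (Inf (snd z)))))"
          by (simp add: RS_sum_def sum_subtractf[symmetric] right_diff_distrib mult.assoc)
        also have "norm \<dots> \<le> (\<Sum>z\<in>p. norm (cnj (\<psi> (Sup (snd z)) - \<psi> (Inf (snd z)))
              - g (fst z) * (\<psi> (Sup (snd z)) - \<psi> (Inf (snd z)))))"
          by (intro sum_norm_le) (simp add: norm_mult norm_exp_i_times)
        finally show ?case
          using elim by linarith
      qed
    qed (rule mesh_filter_neq_bot)
    have "eventually (\<lambda>t. norm (F t) < e / 2) at_top"
      using tendstoD[OF F_lim half] by simp
    then show "eventually (\<lambda>t. dist (\<Psi> (- t)) 0 < e) at_top"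
    proof eventually_elim
      case (elim t)
      have "norm (cnj (\<Psi> (- t))) \<le> norm (cnj (\<Psi> (- t)) - F t) + norm (F t)"
        using norm_triangle_ineq[of "cnj (\<Psi> (- t)) - F t" "F t"] by simp
      then show ?case
        using elim diff[of t] by simp
    qed
  qed
  then have "(\<Psi> \<longlongrightarrow> 0) at_bot"
    by (simp add: filterlim_at_bot_mirror)
  with top show ?thesis
    by (simp add: \<Psi>_def at_infinity_eq_at_top_bot filterlim_sup)
qed

end
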